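(* Write $f(k,m,n)=f_{\text{2--1--2'}}(k,m,n)$. Then for all $n\ge3$: (i) $f(1,m,n)=2^{n-m-2}$ for $1\le m\le n-3$; (ii) $f(1,n-1,n)=2$; (iii) $f(1,n,n)=f(1,n-2,n)=0$.
   Context: The standard cycle form of $\pi\in\mathcal S_n$ writes each cycle starting with its smallest element, cycles listed in decreasing order of smallest elements; $\Psi(\pi)$ is the word obtained by deleting the parentheses. A cyclic occurrence of 2--1--2' in $\pi$ is a triple of indices $i<j<k$ with $w_j<w_i$ and $w_j<w_k$, where $w=\Psi(\pi)$. $f_{\text{2--1--2'}}(k,m,n)$ is the number of $\pi\in\mathcal S_n$ with $m$ cycles and exactly $k$ cyclic occurrences of 2--1--2'. *)

theory Defs
  imports "HOL-Combinatorics.Combinatorics"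
begin

(* An element of S_n is a function p :: nat => nat with p permutes {1..n}.
   Fixed points count as cycles of length 1. *)
definition cycle_sets :: "nat \<Rightarrow> (nat \<Rightarrow> nat) \<Rightarrow> nat set set" where
  "cycle_sets n p = orbit p ` {1..n}"

definition num_cycles :: "nat \<Rightarrow> (nat \<Rightarrow> nat) \<Rightarrow> nat" where
  "num_cycles n p = card (cycle_sets n p)"

(* The library's support p a is the list [a, p a, p (p a), ...] once around the cycle of a. *)
definition standard_cycle_form :: "nat \<Rightarrow> (nat \<Rightarrow> nat) \<Rightarrow> nat list list" where
  "standard_cycle_form n p = map (support p) (rev (sorted_list_of_set (Min ` cycle_sets n p)))"

definition cycle_word :: "nat \<Rightarrow> (nat \<Rightarrow> nat) \<Rightarrow> nat list" where
  "cycle_word n p = concat (standard_cycle_form n p)"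

(* Positions in the word are counted from 0. *)
definition cyclic_occurrences_212' :: "nat \<Rightarrow> (nat \<Rightarrow> nat) \<Rightarrow> (nat \<times> nat \<times> nat) set" where
  "cyclic_occurrences_212' n p =
     (let w = cycle_word n p in
        {(i, j, k). i < j \<and> j < k \<and> k < length w \<and> w ! j < w ! i \<and> w ! j < w ! k})"

definition f_212' :: "nat \<Rightarrow> nat \<Rightarrow> nat \<Rightarrow> nat" where
  "f_212' k m n =
     card {p. p permutes {1..n} \<and> num_cycles n p = m \<and> card (cyclic_occurrences_212' n p) = k}"

end

theory Submission
  imports Defs
begin

text \<open>
  Passing to the word of a permutation turns cycles into left-to-right minima, so the task is to
  count words. An occurrence with middle letter \<open>x\<close> consists of a larger letter on either side of
  \<open>x\<close>; if there is only one occurrence, then exactly two letters exceed its middle letter, which is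
  therefore \<open>n - 2\<close>, and each smaller letter is at the left or right end of the letters
  not below it. Inserting the letters \<open>n - 3, \<dots>, 1\<close> at the ends of one of the two words on
  \<open>n - 2, n - 1, n\<close>, an insertion on the right adds a left-to-right minimum and
  an insertion on the left leaves only one.
\<close>

section \<open>Words with one occurrence\<close>

text \<open>The occurrences in the word \<open>pre @ w\<close> whose middle letter lies in \<open>w\<close>.\<close>

fun valley_count :: "'a::linorder list \<Rightarrow> 'a list \<Rightarrow> nat" where
  "valley_count pre [] = 0"
| "valley_count pre (x # w) =
     length (filter (\<lambda>y. x < y) pre) * length (filter (\<lambda>y. x < y) w) + valley_count (pre @ [x]) w"

text \<open>Induction on \<open>w\<close> moves its first letter into the prefix. Occurrences with
  that letter in the middle are free pairs of a larger letter in \<open>pre\<close> and one in the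
  rest of \<open>w\<close>; all others have their middle further right. Finiteness is carried along
  to make the disjoint union countable.\<close>

lemma card_valleys:
  "finite {(i, j, k). i < j \<and> j < k \<and> k < length (pre @ w) \<and> length pre \<le> j \<and>
              (pre @ w) ! j < (pre @ w) ! i \<and> (pre @ w) ! j < (pre @ w) ! k} \<and>
   card {(i, j, k). i < j \<and> j < k \<and> k < length (pre @ w) \<and> length pre \<le> j \<and>
              (pre @ w) ! j < (pre @ w) ! i \<and> (pre @ w) ! j < (pre @ w) ! k} = valley_count pre w"
proof (induction w arbitrary: pre)
  case Nil
  have "{(i, j, k). i < j \<and> j < k \<and> k < length (pre @ []) \<and> length pre \<le> j \<and>
              (pre @ []) ! j < (pre @ []) ! i \<and> (pre @ []) ! j < (pre @ []) ! k} = {}"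
    by auto
  then show ?case by (metis card.empty finite.emptyI valley_count.simps(1))
next
  case (Cons x w)
  define l where "l = length pre"
  define u where "u = pre @ x # w"
  define S where "S = {(i, j, k). i < j \<and> j < k \<and> k < length u \<and> l \<le> j \<and> u ! j < u ! i \<and> u ! j < u ! k}"
  define T where "T = {(i, j, k). i < j \<and> j < k \<and> k < length u \<and> Suc l \<le> j \<and> u ! j < u ! i \<and> u ! j < u ! k}"
  define I where "I = {i. i < length pre \<and> x < pre ! i}"
  define K where "K = {k. k < length w \<and> x < w ! k}"
  \<comment> \<open>The right index is counted from the start of \<open>w\<close>, which sits at
    position \<open>Suc l\<close> of \<open>u\<close>.\<close>
  define h where "h = (\<lambda>(i :: nat, k). (i, l, Suc l + k))"
  have T: "finite T" "card T = valley_count (pre @ [x]) w"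
    using Cons.IH[of "pre @ [x]"] by (simp_all add: T_def u_def l_def)
  have ul: "u ! l = x" and uw: "\<And>k. u ! (Suc l + k) = w ! k" and up: "\<And>i. i < l \<Longrightarrow> u ! i = pre ! i"
    and lu: "length u = Suc l + length w"
    by (auto simp: u_def l_def nth_append)
  have "S = T \<union> h ` (I \<times> K)"
  proof (intro set_eqI iffI)
    fix t assume "t \<in> S"
    then obtain i j k where t: "t = (i, j, k)" and *: "i < j" "j < k" "k < length u" "l \<le> j"
      "u ! j < u ! i" "u ! j < u ! k"
      by (auto simp: S_def)
    show "t \<in> T \<union> h ` (I \<times> K)"
    proof (cases "j = l")
      case True
      then obtain k' where k': "k = Suc l + k'"
        using * by (metis add_Suc less_imp_Suc_add)
      have "i \<in> I" "k' \<in> K" using * True k' ul uw[of k'] up[of i] lu by (auto simp: I_def K_def l_def)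
      then show ?thesis using t True k' by (auto simp: h_def image_iff)
    qed (use t * in \<open>auto simp: T_def\<close>)
  next
    fix t assume "t \<in> T \<union> h ` (I \<times> K)"
    then show "t \<in> S"
      using ul uw up lu by (auto simp: S_def T_def h_def I_def K_def l_def)
  qed
  moreover have "T \<inter> h ` (I \<times> K) = {}" by (auto simp: T_def h_def)
  moreover have "inj_on h (I \<times> K)" by (auto simp: h_def inj_on_def)
  moreover have "finite I" "finite K" by (auto simp: I_def K_def)
  ultimately have "finite S \<and> card S = card I * card K + valley_count (pre @ [x]) w"
    using T by (simp add: card_Un_disjoint card_image card_cartesian_product)
  moreover have "card I = length (filter (\<lambda>y. x < y) pre)" "card K = length (filter (\<lambda>y. x < y) w)"
    by (simp_all add: I_def K_def length_filter_conv_card)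
  ultimately have "finite S \<and> card S = valley_count pre (x # w)" by simp
  then show ?case by (simp only: S_def u_def l_def)
qed

section \<open>Inserting a smallest letter\<close>

lemma valley_count_remove_min_prefix:
  assumes "\<forall>x\<in>set w. a < x"
  shows "valley_count (pre1 @ a # pre2) w = valley_count (pre1 @ pre2) w"
  using assms by (induction w arbitrary: pre2) auto

text \<open>A smallest letter is never an outer letter of an occurrence. As the middle letter it
  goes with every letter before it and every letter after it, which gives the product.\<close>

lemma valley_count_insert_min:
  assumes "\<forall>x\<in>set (pre @ u @ v). a < x"
  shows "valley_count pre (u @ a # v) = valley_count pre (u @ v) + length (pre @ u) * length v"
  using assms
proof (induction u arbitrary: pre)
  case Nil
  then show ?case
    using valley_count_remove_min_prefix[of v a pre "[]"] by (simp)
qed auto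

text \<open>The blocks begin at the left-to-right minima.\<close>

function blocks :: "'a::linorder list \<Rightarrow> 'a list list" where
  "blocks [] = []"
| "blocks (x # xs) = (x # takeWhile (\<lambda>y. x < y) xs) # blocks (dropWhile (\<lambda>y. x < y) xs)"
  by pat_completeness auto
termination
  by (relation "measure length") (auto simp: le_imp_less_Suc length_dropWhile_le)

text \<open>The new letter lies below the head of every block, so no block absorbs it and it forms a
  last block of its own.\<close>

lemma blocks_snoc_min: "\<forall>x\<in>set w. a < x \<Longrightarrow> blocks (w @ [a]) = blocks w @ [[a]]"
proof (induction w rule: blocks.induct)
  case (2 x xs)
  have eq: "takeWhile (\<lambda>y. x < y) (xs @ [a]) = takeWhile (\<lambda>y. x < y) xs"
      "dropWhile (\<lambda>y. x < y) (xs @ [a]) = dropWhile (\<lambda>y. x < y) xs @ [a]"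
    using "2.prems" by (induction xs) auto
  have "\<forall>y\<in>set (dropWhile (\<lambda>y. x < y) xs). a < y"
    using "2.prems" set_dropWhileD by fastforce
  with "2.IH" show ?case by (simp add: eq)
qed simp

lemma blocks_Cons_min: "\<forall>x\<in>set w. a < x \<Longrightarrow> blocks (a # w) = [a # w]"
  by (simp add: takeWhile_eq_all_conv[THEN iffD2] dropWhile_eq_Nil_conv[THEN iffD2])

text \<open>The parentheses of a standard form can be recovered: \<open>takeWhile\<close> runs
  through the tail of a block, whose letters exceed its head, and stops at the next head, which is
  smaller.\<close>

lemma blocks_concat:
  assumes "\<forall>L\<in>set Ls. \<exists>x xs. L = x # xs \<and> (\<forall>y\<in>set xs. x < y)"
    and "sorted_wrt (>) (map hd Ls)"
  shows "blocks (concat Ls) = Ls"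
  using assms
proof (induction Ls)
  case (Cons L Ls)
  obtain x xs where L: "L = x # xs" "\<forall>y\<in>set xs. x < y" using Cons.prems by auto
  have "takeWhile (\<lambda>y. x < y) (concat Ls) = [] \<and> dropWhile (\<lambda>y. x < y) (concat Ls) = concat Ls"
  proof (cases Ls)
    case (Cons M Ms)
    then obtain z zs where "M = z # zs" "z < x" using Cons.prems L by auto
    with Cons show ?thesis by simp
  qed simp
  then show ?case using Cons L by (simp add: takeWhile_append2 dropWhile_append2)
qed simp

section \<open>Structure of the words with exactly one occurrence\<close>

definition one_valley_words :: "'a::linorder set \<Rightarrow> 'a list set" where
  "one_valley_words A = {w \<in> permutations_of_set A. valley_count [] w = 1}"

lemma finite_one_valley_words [simp]: "finite (one_valley_words A)"
  by (simp add: one_valley_words_def)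

lemma one_valley_words_insert_min:
  assumes A: "finite A" "card A \<ge> 3" and a: "\<forall>x\<in>A. a < x"
  shows "one_valley_words (insert a A) = Cons a ` one_valley_words A \<union> (\<lambda>w. w @ [a]) ` one_valley_words A"
proof (intro set_eqI iffI)
  fix w assume w: "w \<in> one_valley_words (insert a A)"
  have "a \<in> set w" using w by (auto simp: one_valley_words_def permutations_of_set_def)
  then obtain u v where uv: "w = u @ a # v" by (meson split_list)
  have "set (u @ v) = A" "distinct (u @ v)"
    using w uv a by (auto simp: one_valley_words_def permutations_of_set_def)
  then have perm: "u @ v \<in> permutations_of_set A" and len: "length u + length v \<ge> 3"
    using A distinct_card[of "u @ v"] by (auto simp: permutations_of_set_def)
  have "1 = valley_count [] (u @ v) + length u * length v"
    using valley_count_insert_min[of "[]" u v a] a \<open>set (u @ v) = A\<close> w uv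
    by (auto simp: one_valley_words_def)
  \<comment> \<open>A product of 1 would put one letter on each side of \<open>a\<close>, that is,
    only two other letters in all. This is where three letters in \<open>A\<close> are
    required.\<close>
  moreover have "length u * length v \<noteq> 1"
    using len by auto
  ultimately have "length u * length v = 0 \<and> valley_count [] (u @ v) = 1"
    by linarith
  then show "w \<in> Cons a ` one_valley_words A \<union> (\<lambda>w. w @ [a]) ` one_valley_words A"
    using perm uv by (auto simp: one_valley_words_def)
next
  fix w assume "w \<in> Cons a ` one_valley_words A \<union> (\<lambda>w. w @ [a]) ` one_valley_words A"
  then obtain v where v: "v \<in> one_valley_words A" "w = a # v \<or> w = v @ [a]" by auto
  then show "w \<in> one_valley_words (insert a A)"
    using a valley_count_insert_min[of "[]" "[]" v a] valley_count_insert_min[of "[]" v "[]" a]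
    by (auto simp: one_valley_words_def permutations_of_set_def simp del: valley_count.simps)
qed

text \<open>Base case: among three letters an occurrence must use all of them, with the least in the
  middle.\<close>

lemma one_valley_words_three:
  assumes "a < b" "b < c"
  shows "one_valley_words {a, b, c} = {[b, a, c], [c, a, b]}"
proof -
  have perms: "permutations_of_set {a, b, c} = {[a, b, c], [a, c, b], [b, a, c], [b, c, a], [c, a, b], [c, b, a]}"
    using assms by (subst permutations_of_set_nonempty) (auto simp: permutations_of_set_doubleton insert_Diff_if)
  have "\<not> b < a" "\<not> c < b" "\<not> c < a" "a < c" using assms by auto
  then have counts: "valley_count [] [a, b, c] = 0" "valley_count [] [a, c, b] = 0"
    "valley_count [] [b, a, c] = 1" "valley_count [] [b, c, a] = 0"
    "valley_count [] [c, a, b] = 1" "valley_count [] [c, b, a] = 0"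
    using assms by simp_all
  show ?thesis
  proof (intro set_eqI iffI)
    fix w assume "w \<in> one_valley_words {a, b, c}"
    then have "valley_count [] w = 1" "w \<in> permutations_of_set {a, b, c}"
      by (simp_all only: one_valley_words_def mem_Collect_eq)
    then show "w \<in> {[b, a, c], [c, a, b]}"
      unfolding perms using counts by (metis insertE insertI1 insertI2 singletonD zero_neq_one)
  next
    fix w assume "w \<in> {[b, a, c], [c, a, b]}"
    then show "w \<in> one_valley_words {a, b, c}"
      unfolding one_valley_words_def perms using counts by (elim insertE emptyE) simp_all
  qed
qed

section \<open>Counting these words by their number of blocks\<close>

definition num_one_valley :: "'a::linorder set \<Rightarrow> nat \<Rightarrow> nat" where
  "num_one_valley A m = card {w \<in> one_valley_words A. length (blocks w) = m}"

text \<open>Each word on \<open>A\<close> gives two words, with \<open>a\<close> at the front or at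
  the end. At the end \<open>a\<close> adds a block; at the front it absorbs the whole word into a
  single block, so all those words are counted at \<open>Suc m = 1\<close>.\<close>

lemma one_valley_words_insert_min_counts:
  assumes A: "finite A" "card A \<ge> 3" and a: "\<forall>x\<in>A. a < x"
  shows "card (one_valley_words (insert a A)) = 2 * card (one_valley_words A)"
    and "num_one_valley (insert a A) (Suc m) =
           num_one_valley A m + (if m = 0 then card (one_valley_words A) else 0)"
proof -
  let ?W = "one_valley_words A"
  let ?snoc = "\<lambda>w. w @ [a]"
  have set_W: "set w = A" if "w \<in> ?W" for w
    using that by (auto simp: one_valley_words_def permutations_of_set_def)
  have ne: "a # v \<noteq> w @ [a]" if "v \<in> ?W" "w \<in> ?W" for v w
  proof
    assume "a # v = w @ [a]"
    then have "w = [] \<or> a \<in> set w" by (cases w) auto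
    then show False using set_W[OF that(2)] A a by auto
  qed
  then have disj: "Cons a ` ?W \<inter> ?snoc ` ?W = {}" by auto
  have inj: "inj_on (Cons a) X" "inj_on ?snoc X" for X by (auto simp: inj_on_def)
  show "card (one_valley_words (insert a A)) = 2 * card ?W"
    unfolding one_valley_words_insert_min[OF assms]
    using disj by (simp add: card_Un_disjoint card_image inj)
  have Cons: "length (blocks (a # w)) = 1" if "w \<in> ?W" for w
    using blocks_Cons_min[of w a] set_W[OF that] a by simp
  have snoc: "length (blocks (w @ [a])) = Suc (length (blocks w))" if "w \<in> ?W" for w
    using blocks_snoc_min[of w a] set_W[OF that] a by simp
  have "{w \<in> one_valley_words (insert a A). length (blocks w) = Suc m} =
     ?snoc ` {w \<in> ?W. length (blocks w) = m} \<union> Cons a ` (if m = 0 then ?W else {})"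
    unfolding one_valley_words_insert_min[OF assms] using Cons snoc by auto
  moreover have "?snoc ` {w \<in> ?W. length (blocks w) = m} \<inter> Cons a ` (if m = 0 then ?W else {}) = {}"
    using disj by auto
  ultimately show "num_one_valley (insert a A) (Suc m) = num_one_valley A m + (if m = 0 then card ?W else 0)"
    unfolding num_one_valley_def by (simp add: card_Un_disjoint card_image inj)
qed

lemma num_one_valley_zero: "A \<noteq> {} \<Longrightarrow> num_one_valley A 0 = 0"
proof -
  assume "A \<noteq> {}"
  then have "blocks w \<noteq> []" if "w \<in> one_valley_words A" for w
    using that by (cases w) (auto simp: one_valley_words_def permutations_of_set_def)
  then show ?thesis by (simp add: num_one_valley_def)
qed

text \<open>Induction by removing the minimum, stated for arbitrary finite sets because {1..n}
  without 1 is no longer of that form. The total is carried along since it supplies the number of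
  words with one block at the next size.\<close>

lemma num_one_valley_eq:
  assumes "finite A" "card A \<ge> 3"
  shows "card (one_valley_words A) = 2 ^ (card A - 2) \<and>
    (\<forall>m. num_one_valley A m =
      (if 1 \<le> m \<and> m + 3 \<le> card A then 2 ^ (card A - m - 2) else if m + 1 = card A then 2 else 0))"
  using assms
proof (induction "card A" arbitrary: A rule: less_induct)
  case less
  define a where "a = Min A"
  define B where "B = A - {a}"
  have "A \<noteq> {}" using less.prems by auto
  then have "a \<in> A" using less.prems by (simp add: a_def)
  then have A: "A = insert a B" "finite B" "card A = Suc (card B)"
    using less.prems card_Suc_Diff1[of A a] by (auto simp: B_def)
  have a: "\<forall>x\<in>B. a < x"
    using less.prems by (auto simp: B_def a_def less_le)
  show ?case
  proof (cases "card B \<ge> 3")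
    case True
    note IH = less.hyps[of B, OF _ A(2) True]
    have "num_one_valley A m =
      (if 1 \<le> m \<and> m + 3 \<le> card A then 2 ^ (card A - m - 2) else if m + 1 = card A then 2 else 0)" for m
    proof (cases m)
      case 0
      then show ?thesis using num_one_valley_zero[OF \<open>A \<noteq> {}\<close>] True A(3) by simp
    next
      case (Suc m')
      have "num_one_valley A m = num_one_valley B m' + (if m' = 0 then card (one_valley_words B) else 0)"
        using one_valley_words_insert_min_counts(2)[OF A(2) True a] Suc A(1) by simp
      \<comment> \<open>For \<open>m' = 0\<close> only the total for \<open>B\<close> contributes;
        otherwise the value carries over, as passing from \<open>B\<close> to \<open>A\<close>
        raises size and number of blocks together.\<close>
      then show ?thesis using IH True A(3) Suc by (auto simp: numeral_eq_Suc)
    qed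
    moreover have "card A - 2 = Suc (card B - 2)" using A(3) True by simp
    then have "card (one_valley_words A) = 2 ^ (card A - 2)"
      using one_valley_words_insert_min_counts(1)[OF A(2) True a] IH A(1) by simp
    ultimately show ?thesis by blast
  next
    case False
    then have "card B = 2" using A less.prems by simp
    then obtain b c where "B = {b, c}" "b < c"
      by (metis card_2_iff insert_commute neqE)
    then have AW: "A = {a, b, c}" "a < b" "b < c" using A a by auto
    have card: "card A = 3" using A(3) \<open>card B = 2\<close> by simp
    have W: "one_valley_words A = {[b, a, c], [c, a, b]}"
      using one_valley_words_three AW by blast
    \<comment> \<open>In both words a new block begins exactly at \<open>a\<close>.\<close>
    have "length (blocks w) = 2" if "w \<in> one_valley_words A" for w
      using that AW(2,3) unfolding W by auto
    then have "num_one_valley A m = (if m = 2 then card (one_valley_words A) else 0)" for m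
      unfolding num_one_valley_def by (auto intro: arg_cong[where f = card])
    moreover have "card (one_valley_words A) = 2" using AW W by simp
    ultimately show ?thesis using card by simp
  qed
qed

section \<open>The word of a permutation\<close>

context
  fixes n :: nat and p :: "nat \<Rightarrow> nat"
  assumes p: "p permutes {1..n}"
begin

lemma permutation_p: "permutation p"
  using p by (auto simp: permutation_permutes)

lemma set_support: "set (support p a) = orbit p a"
  using support_set[OF permutation_p] orbit_altdef_permutation[OF permutation_p] by auto

lemma orbit_eq: "x \<in> orbit p y \<Longrightarrow> orbit p x = orbit p y"
  using cyclic_on_orbit'[OF permutation_p] orbit_cyclic_eq3 by metis

text \<open>A cycle is the orbit of its minimum, so listing the minima, as the standard form does,
  loses no cycle.\<close>

lemma cycle_sets_Min:
  assumes "c \<in> cycle_sets n p"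
  shows "finite c" "Min c \<in> c" "orbit p (Min c) = c" "c \<subseteq> {1..n}"
proof -
  obtain x where x: "x \<in> {1..n}" "c = orbit p x" using assms by (auto simp: cycle_sets_def)
  show "c \<subseteq> {1..n}" using permutes_orbit_subset[OF p] x by blast
  then show "finite c" using finite_subset by blast
  then show "Min c \<in> c" using x orbit_nonempty by (metis Min_in)
  then show "orbit p (Min c) = c" using x orbit_eq by blast
qed

lemma support_Cons: "\<exists>xs. support p a = a # xs"
proof -
  \<comment> \<open>The least power is positive, so the list starts with the zeroth iterate,
    \<open>a\<close> itself.\<close>
  have "[0..<least_power p a] = 0 # [1..<least_power p a]"
    using least_power_of_permutation(2)[OF permutation_p] by (simp add: upt_conv_Cons)
  then show ?thesis by simp
qed

lemma hd_support: "hd (support p a) = a"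
  using support_Cons[of a] by auto

lemma Min_cycle_sets:
  shows "finite (Min ` cycle_sets n p)" "card (Min ` cycle_sets n p) = num_cycles n p"
proof -
  show "finite (Min ` cycle_sets n p)" by (simp add: cycle_sets_def)
  have "inj_on Min (cycle_sets n p)" by (metis cycle_sets_Min(3) inj_onI)
  then show "card (Min ` cycle_sets n p) = num_cycles n p"
    by (simp add: num_cycles_def card_image)
qed

text \<open>Both hypotheses of \<open>blocks_concat\<close> are the conventions of the standard
  form: each cycle starts with its minimum, and the minima decrease.\<close>

lemma blocks_cycle_word: "blocks (cycle_word n p) = standard_cycle_form n p"
proof -
  let ?M = "rev (sorted_list_of_set (Min ` cycle_sets n p))"
  show ?thesis unfolding cycle_word_def
  proof (rule blocks_concat)
    have "map hd (standard_cycle_form n p) = map id ?M"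
      by (simp only: standard_cycle_form_def map_map comp_def hd_support id_def)
    then show "sorted_wrt (>) (map hd (standard_cycle_form n p))"
      by (simp add: sorted_wrt_rev)
  next
    show "\<forall>L\<in>set (standard_cycle_form n p). \<exists>x xs. L = x # xs \<and> (\<forall>y\<in>set xs. x < y)"
    proof
      fix L assume "L \<in> set (standard_cycle_form n p)"
      then obtain c where c: "c \<in> cycle_sets n p" "L = support p (Min c)"
        using Min_cycle_sets(1) by (auto simp: standard_cycle_form_def)
      obtain xs where xs: "L = Min c # xs" using support_Cons c by metis
      have "set L = c" using c cycle_sets_Min(3) set_support by metis
      moreover have "distinct L" using c cycle_of_permutation[OF permutation_p] by metis
      ultimately have "\<forall>y\<in>set xs. Min c < y"
        using xs cycle_sets_Min(1)[OF c(1)] by (metis Min_le distinct.simps(2) le_neq_implies_less list.set_intros(2))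
      with xs show "\<exists>x xs. L = x # xs \<and> (\<forall>y\<in>set xs. x < y)" by blast
    qed
  qed
qed

lemma num_cycles_eq_blocks: "num_cycles n p = length (blocks (cycle_word n p))"
  using Min_cycle_sets by (simp add: blocks_cycle_word standard_cycle_form_def)

lemma set_cycle_word: "set (cycle_word n p) = {1..n}"
proof -
  have "set (cycle_word n p) = (\<Union>c\<in>cycle_sets n p. orbit p (Min c))"
    using Min_cycle_sets(1) set_support by (simp add: cycle_word_def standard_cycle_form_def)
  also have "\<dots> = \<Union> (cycle_sets n p)" using cycle_sets_Min(3) by auto
  also have "\<dots> = {1..n}"
  proof
    show "{1..n} \<subseteq> \<Union> (cycle_sets n p)"
      using permutation_self_in_orbit[OF permutation_p] by (auto simp: cycle_sets_def)
  qed (use cycle_sets_Min(4) in auto)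
  finally show ?thesis .
qed

lemma distinct_cycle_word: "distinct (cycle_word n p)"
  unfolding cycle_word_def
proof (rule distinct_concat)
  let ?M = "rev (sorted_list_of_set (Min ` cycle_sets n p))"
  have blockE: "\<exists>c\<in>cycle_sets n p. L = support p (Min c) \<and> set L = c"
    if L: "L \<in> set (standard_cycle_form n p)" for L
  proof -
    obtain c where "c \<in> cycle_sets n p" "L = support p (Min c)"
      using L Min_cycle_sets(1) by (auto simp: standard_cycle_form_def)
    then show ?thesis using cycle_sets_Min(3) set_support by metis
  qed
  \<comment> \<open>\<open>hd\<close> is a left inverse of \<open>support p\<close>.\<close>
  have "inj_on (support p) (set ?M)"
    using hd_support by (rule inj_on_inverseI)
  then show "distinct (standard_cycle_form n p)"
    by (simp only: standard_cycle_form_def distinct_map distinct_rev distinct_sorted_list_of_set)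
  show "distinct L" if "L \<in> set (standard_cycle_form n p)" for L
    using blockE[OF that] cycle_of_permutation[OF permutation_p] by metis
  fix L L' assume "L \<in> set (standard_cycle_form n p)" "L' \<in> set (standard_cycle_form n p)" "L \<noteq> L'"
  then obtain c c' where c: "c \<in> cycle_sets n p" "set L = c" and c': "c' \<in> cycle_sets n p" "set L' = c'"
    and ne: "c \<noteq> c'"
    using blockE by metis
  have "c \<inter> c' = {}"
  proof (rule ccontr)
    assume "c \<inter> c' \<noteq> {}"
    \<comment> \<open>Two orbits with a common point are equal.\<close>
    then have "c = c'" using cycle_sets_Min(3)[OF c(1)] cycle_sets_Min(3)[OF c'(1)] orbit_eq
      by (metis disjoint_iff)
    with ne show False ..
  qed
  then show "set L \<inter> set L' = {}" using c c' by simp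
qed

lemma card_cyclic_occurrences: "card (cyclic_occurrences_212' n p) = valley_count [] (cycle_word n p)"
  using card_valleys[of "[]" "cycle_word n p"] by (simp add: cyclic_occurrences_212'_def Let_def)

text \<open>The word determines its blocks, and each block read cyclically gives the images under
  \<open>p\<close>. This yields injectivity of \<open>cycle_word n\<close>.\<close>

lemma cycle_word_determines_image:
  assumes "x \<in> {1..n}"
  shows "\<exists>L\<in>set (blocks (cycle_word n p)). x \<in> set L"
    and "L \<in> set (blocks (cycle_word n p)) \<Longrightarrow> x \<in> set L \<Longrightarrow> p x = cycle_of_list L x"
proof -
  show "\<exists>L\<in>set (blocks (cycle_word n p)). x \<in> set L"
    using assms set_cycle_word unfolding blocks_cycle_word by (auto simp: cycle_word_def)
  show "p x = cycle_of_list L x" if "L \<in> set (blocks (cycle_word n p))" "x \<in> set L"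
  proof -
    have "L \<in> range (support p)"
      using that(1) unfolding blocks_cycle_word standard_cycle_form_def by auto
    then obtain a where "L = support p a" by blast
    then show ?thesis using that cycle_restrict[OF permutation_p] by metis
  qed
qed

end

section \<open>Transfer from words to permutations\<close>

lemma bij_betw_cycle_word:
  "bij_betw (cycle_word n) {p. p permutes {1..n}} (permutations_of_set {1..n})"
proof -
  have "inj_on (cycle_word n) {p. p permutes {1..n}}"
  proof (rule inj_onI, clarify)
    fix p q assume p: "p permutes {1..n}" and q: "q permutes {1..n}" and eq: "cycle_word n p = cycle_word n q"
    have "p x = q x" for x
    proof (cases "x \<in> {1..n}")
      case True
      then show ?thesis
        using cycle_word_determines_image[OF p True] cycle_word_determines_image[OF q True] eq by metis
    next
      case False
      then show ?thesis using p q by (simp add: permutes_def)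
    qed
    then show "p = q" by blast
  qed
  moreover have "cycle_word n ` {p. p permutes {1..n}} = permutations_of_set {1..n}"
  proof (rule card_subset_eq)
    show "cycle_word n ` {p. p permutes {1..n}} \<subseteq> permutations_of_set {1..n}"
      using set_cycle_word distinct_cycle_word by (auto intro!: permutations_of_setI)
    \<comment> \<open>Surjectivity follows by counting: injectivity gives n! words in the image, and
      there are n! arrangements of {1..n}.\<close>
    show "card (cycle_word n ` {p. p permutes {1..n}}) = card (permutations_of_set {1..n})"
      using calculation card_permutations[of "{1..n}" n] by (simp add: card_image)
  qed simp
  ultimately show ?thesis by (simp add: bij_betw_def)
qed

lemma f_212'_eq_num_one_valley: "f_212' 1 m n = num_one_valley {1..n} m"
proof -
  have "bij_betw (cycle_word n)
      {p \<in> {p. p permutes {1..n}}. num_cycles n p = m \<and> card (cyclic_occurrences_212' n p) = 1}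
      {w \<in> permutations_of_set {1..n}. length (blocks w) = m \<and> valley_count [] w = 1}"
    by (rule bij_betw_Collect[OF bij_betw_cycle_word])
      (simp add: num_cycles_eq_blocks card_cyclic_occurrences)
  then show ?thesis
    using bij_betw_same_card
    by (fastforce simp: f_212'_def num_one_valley_def one_valley_words_def conj_commute conj_left_commute)
qed

theorem mainTheorem17:
  fixes n :: nat
  assumes "n \<ge> 3"
  shows "(\<forall>m. 1 \<le> m \<and> m \<le> n - 3 \<longrightarrow> f_212' 1 m n = 2 ^ (n - m - 2)) \<and>
         f_212' 1 (n - 1) n = 2 \<and>
         f_212' 1 n n = 0 \<and> f_212' 1 (n - 2) n = 0"
proof -
  have "f_212' 1 m n = (if 1 \<le> m \<and> m + 3 \<le> n then 2 ^ (n - m - 2) else if m + 1 = n then 2 else 0)" for m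
    using num_one_valley_eq[of "{1..n}"] assms unfolding f_212'_eq_num_one_valley by simp
  \<comment> \<open>The values \<open>n\<close> and \<open>n - 2\<close> of \<open>m\<close> miss
    both the range \<open>m + 3 \<le> n\<close> and the case \<open>m + 1 = n\<close>, hence give
    0.\<close>
  then show ?thesis using assms by auto
qed

end
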